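(* Let $k\geq1$ and let $\delta\in\mathbb{R}^{k\times k}$ be a matrix such that for every $i_0,j_0\in[k]$, $\sum_{j\in[k]}\delta_{i_0,j}=\sum_{i\in[k]}\delta_{i,j_0}=0$. Let $X=(X_1,\dots,X_k)$ and $Y=(Y_1,\dots,Y_k)$ be independent random vectors, each uniformly distributed over $\{0,1\}^k$, and define $Z=\sum_{(i,j)\in[k]\times[k]}\delta_{ij}X_iY_j$. Then for every $\alpha\in(0,1/16)$ there exists a constant $c_\alpha>0$ (not depending on $k$ or $\delta$) such that $$\Pr\big[Z^2\geq\alpha\|\delta\|_F^2\big]\geq c_\alpha.$$ Moreover, one can take $c_\alpha=\frac{(1-16\alpha)^2}{1024}$.
   Context: $[k]=\{1,\dots,k\}$; $\|\delta\|_F=\big(\sum_{i,j}\delta_{ij}^2\big)^{1/2}$ is the Frobenius norm. *)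

theory Defs
  imports "HOL-Probability.Probability"
begin

text \<open>
  A real \<open>k \<times> k\<close> matrix is a function \<open>nat \<Rightarrow> nat \<Rightarrow> real\<close>, of which only the entries with both
  indices in \<open>{1..k}\<close> are ever used; the size has to be a number rather than a type because the
  constant is chosen before \<open>k\<close>.
\<close>

definition zero_line_sums :: "nat \<Rightarrow> (nat \<Rightarrow> nat \<Rightarrow> real) \<Rightarrow> bool" where
  "zero_line_sums k \<delta> \<longleftrightarrow>
     (\<forall>i0\<in>{1..k}. \<forall>j0\<in>{1..k}. (\<Sum>j\<in>{1..k}. \<delta> i0 j) = 0 \<and> (\<Sum>i\<in>{1..k}. \<delta> i j0) = 0)"

definition frob_norm :: "nat \<Rightarrow> (nat \<Rightarrow> nat \<Rightarrow> real) \<Rightarrow> real" where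
  "frob_norm k \<delta> = sqrt (\<Sum>(i, j)\<in>{1..k} \<times> {1..k}. (\<delta> i j)\<^sup>2)"

definition bilin :: "nat \<Rightarrow> (nat \<Rightarrow> nat \<Rightarrow> real) \<Rightarrow> (nat \<Rightarrow> real) \<Rightarrow> (nat \<Rightarrow> real) \<Rightarrow> real" where
  "bilin k \<delta> x y = (\<Sum>(i, j)\<in>{1..k} \<times> {1..k}. \<delta> i j * x i * y j)"

definition cube :: "nat \<Rightarrow> (nat \<Rightarrow> real) set" where
  "cube k = {1..k} \<rightarrow>\<^sub>E {0, 1}"

text \<open>Measurability of both vectors is part of \<^const>\<open>prob_space.indep_var\<close>.\<close>

definition indep_uniform_cube ::
  "'a measure \<Rightarrow> nat \<Rightarrow> ('a \<Rightarrow> nat \<Rightarrow> real) \<Rightarrow> ('a \<Rightarrow> nat \<Rightarrow> real) \<Rightarrow> bool" where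
  "indep_uniform_cube M k X Y \<longleftrightarrow>
     prob_space M \<and>
     prob_space.indep_var M (count_space (cube k)) X (count_space (cube k)) Y \<and>
     distr M (count_space (cube k)) X = uniform_count_measure (cube k) \<and>
     distr M (count_space (cube k)) Y = uniform_count_measure (cube k)"

end

theory Submission
  imports Defs
begin

text \<open>
  As the line sums of \<open>\<delta>\<close> vanish, \<open>Z\<close> does not change when \<open>X\<close> and \<open>Y\<close> are centred by \<open>1 / 2\<close>,
  and then \<open>E Z\<^sup>2 = \<parallel>\<delta>\<parallel>\<^sub>F\<^sup>2 / 16\<close>. The kurtosis of a sum of independent centred variables is at most
  3 if theirs is, because the Gaussian value 3 makes the cross term \<open>6 E U\<^sup>2 E V\<^sup>2\<close> fit into
  \<open>3 (E U\<^sup>2 + E V\<^sup>2)\<^sup>2\<close>. Conditionally on \<open>X\<close> the variable \<open>Z\<close> is such a sum in \<open>Y\<close>, with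
  coefficients that are themselves such sums in \<open>X\<close>, so \<open>E Z\<^sup>4 \<le> 9 (E Z\<^sup>2)\<^sup>2\<close>. The Paley-Zygmund
  inequality for \<open>Z\<^sup>2\<close> gives the probability bound \<open>(1 - 16 \<alpha>)\<^sup>2 / 9\<close>.
\<close>

subsection \<open>Integrability and the Paley-Zygmund inequality\<close>

lemma integrable_mult_of_power2:
  fixes f g :: "'a \<Rightarrow> real"
  assumes [measurable]: "f \<in> borel_measurable M" "g \<in> borel_measurable M"
    and "integrable M (\<lambda>x. (f x)\<^sup>2)" "integrable M (\<lambda>x. (g x)\<^sup>2)"
  shows "integrable M (\<lambda>x. f x * g x)"
proof (rule Bochner_Integration.integrable_bound)
  show "integrable M (\<lambda>x. (f x)\<^sup>2 + (g x)\<^sup>2)"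
    using assms by simp
  show "AE x in M. norm (f x * g x) \<le> norm ((f x)\<^sup>2 + (g x)\<^sup>2)"
  proof (rule AE_I2)
    fix x
    have "2 * \<bar>f x * g x\<bar> \<le> (f x)\<^sup>2 + (g x)\<^sup>2"
      using sum_squares_bound[of "\<bar>f x\<bar>" "\<bar>g x\<bar>"] by (simp add: abs_mult)
    then show "norm (f x * g x) \<le> norm ((f x)\<^sup>2 + (g x)\<^sup>2)"
      by simp
  qed
qed measurable

lemma Cauchy_Schwarz_integral:
  fixes f g :: "'a \<Rightarrow> real"
  assumes [measurable]: "f \<in> borel_measurable M" "g \<in> borel_measurable M"
    and f: "integrable M (\<lambda>x. (f x)\<^sup>2)" and g: "integrable M (\<lambda>x. (g x)\<^sup>2)"
  shows "(\<integral>x. f x * g x \<partial>M)\<^sup>2 \<le> (\<integral>x. (f x)\<^sup>2 \<partial>M) * (\<integral>x. (g x)\<^sup>2 \<partial>M)"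
proof -
  have int_fg: "integrable M (\<lambda>x. \<bar>f x * g x\<bar>)"
    using integrable_mult_of_power2[OF assms] by simp
  have "ennreal ((\<integral>x. \<bar>f x * g x\<bar> \<partial>M)\<^sup>2) = (\<integral>\<^sup>+x. ennreal \<bar>f x\<bar> * ennreal \<bar>g x\<bar> \<partial>M)\<^sup>2"
    using int_fg by (simp add: ennreal_power nn_integral_eq_integral abs_mult flip: ennreal_mult)
  also have "\<dots> \<le> (\<integral>\<^sup>+x. (ennreal \<bar>f x\<bar>)\<^sup>2 \<partial>M) * (\<integral>\<^sup>+x. (ennreal \<bar>g x\<bar>)\<^sup>2 \<partial>M)"
    by (rule Cauchy_Schwarz_nn_integral) measurable
  also have "\<dots> = ennreal ((\<integral>x. (f x)\<^sup>2 \<partial>M) * (\<integral>x. (g x)\<^sup>2 \<partial>M))"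
    using f g by (simp add: ennreal_power nn_integral_eq_integral ennreal_mult)
  finally have "(\<integral>x. \<bar>f x * g x\<bar> \<partial>M)\<^sup>2 \<le> (\<integral>x. (f x)\<^sup>2 \<partial>M) * (\<integral>x. (g x)\<^sup>2 \<partial>M)"
    by (simp add: ennreal_le_iff)
  moreover have "(\<integral>x. f x * g x \<partial>M)\<^sup>2 \<le> (\<integral>x. \<bar>f x * g x\<bar> \<partial>M)\<^sup>2"
    using integral_abs_bound[of M "\<lambda>x. f x * g x"] by (intro power2_le_iff_abs_le[THEN iffD2]) auto
  ultimately show ?thesis
    by linarith
qed

lemma (in finite_measure) integrable_power_mono:
  fixes f :: "'a \<Rightarrow> real"
  assumes [measurable]: "f \<in> borel_measurable M"
    and "integrable M (\<lambda>x. f x ^ n)" "m \<le> n"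
  shows "integrable M (\<lambda>x. f x ^ m)"
proof (rule Bochner_Integration.integrable_bound)
  show "integrable M (\<lambda>x. 1 + \<bar>f x ^ n\<bar>)"
    using assms by simp
  show "AE x in M. norm (f x ^ m) \<le> norm (1 + \<bar>f x ^ n\<bar>)"
  proof (rule AE_I2)
    fix x
    show "norm (f x ^ m) \<le> norm (1 + \<bar>f x ^ n\<bar>)"
      using power_increasing[of m n "\<bar>f x\<bar>"] power_le_one[of "\<bar>f x\<bar>" m] \<open>m \<le> n\<close>
      by (cases "1 \<le> \<bar>f x\<bar>") (auto simp: power_abs intro: add_increasing2)
  qed
qed measurable

lemma (in pair_sigma_finite) Fubini_integrable_bound:
  fixes f :: "'a \<times> 'b \<Rightarrow> real" and g :: "'a \<Rightarrow> real"
  assumes [measurable]: "f \<in> borel_measurable (M1 \<Otimes>\<^sub>M M2)"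
    and "integrable M1 g"
    and "\<And>x. x \<in> space M1 \<Longrightarrow> integrable M2 (\<lambda>y. f (x, y))"
    and "\<And>x. x \<in> space M1 \<Longrightarrow> (\<integral>y. \<bar>f (x, y)\<bar> \<partial>M2) \<le> g x"
  shows "integrable (M1 \<Otimes>\<^sub>M M2) f"
proof (rule Fubini_integrable)
  show "integrable M1 (\<lambda>x. \<integral>y. norm (f (x, y)) \<partial>M2)"
    using assms(2)
  proof (rule Bochner_Integration.integrable_bound)
    show "AE x in M1. norm (\<integral>y. norm (f (x, y)) \<partial>M2) \<le> norm (g x)"
      using assms(4) by (intro AE_I2) (simp add: order.trans[OF _ abs_ge_self])
  qed measurable
qed (use assms in auto)

lemma (in prob_space) Paley_Zygmund:
  assumes [measurable]: "random_variable borel X"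
    and square_integrable: "integrable M (\<lambda>\<omega>. (X \<omega>)\<^sup>2)"
    and "0 \<le> expectation X" "0 \<le> \<theta>" "\<theta> \<le> 1"
  shows "(1 - \<theta>)\<^sup>2 * (expectation X)\<^sup>2
    \<le> expectation (\<lambda>\<omega>. (X \<omega>)\<^sup>2) * prob {\<omega> \<in> space M. \<theta> * expectation X \<le> X \<omega>}"
proof -
  define A where "A = {\<omega> \<in> space M. \<theta> * expectation X \<le> X \<omega>}"
  have [measurable]: "A \<in> events"
    unfolding A_def by measurable
  have int_X: "integrable M X"
    using square_integrable by (rule square_integrable_imp_integrable[rotated]) measurable
  have indicator_power2: "(indicator A \<omega> :: real)\<^sup>2 = indicator A \<omega>" for \<omega>
    by (simp add: indicator_def)
  have int_X_on_A: "integrable M (\<lambda>\<omega>. X \<omega> * indicator A \<omega>)"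
    using int_X by (intro integrable_real_mult_indicator) auto
  have "expectation X \<le> expectation (\<lambda>\<omega>. \<theta> * expectation X + X \<omega> * indicator A \<omega>)"
    using assms int_X int_X_on_A by (intro integral_mono) (auto simp: A_def indicator_def)
  also have "\<dots> = \<theta> * expectation X + expectation (\<lambda>\<omega>. X \<omega> * indicator A \<omega>)"
    using int_X_on_A by (simp add: prob_space)
  finally have "(1 - \<theta>) * expectation X \<le> expectation (\<lambda>\<omega>. X \<omega> * indicator A \<omega>)"
    by (simp add: algebra_simps)
  then have "((1 - \<theta>) * expectation X)\<^sup>2 \<le> (expectation (\<lambda>\<omega>. X \<omega> * indicator A \<omega>))\<^sup>2"
    using assms by (intro power_mono) auto
  also have "\<dots> \<le> expectation (\<lambda>\<omega>. (X \<omega>)\<^sup>2) * expectation (\<lambda>\<omega>. (indicator A \<omega>)\<^sup>2)"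
    using square_integrable
    by (intro Cauchy_Schwarz_integral) (auto simp: indicator_power2 emeasure_eq_measure)
  also have "expectation (\<lambda>\<omega>. (indicator A \<omega>)\<^sup>2) = prob A"
    by (simp add: indicator_power2)
  finally show ?thesis
    by (simp add: A_def power_mult_distrib)
qed

subsection \<open>Centred variables of bounded kurtosis\<close>

text \<open>The fraction is cleared, so that a variable vanishing almost surely is included.\<close>

definition kurtosis_le :: "'a measure \<Rightarrow> real \<Rightarrow> ('a \<Rightarrow> real) \<Rightarrow> bool" where
  "kurtosis_le M K X \<longleftrightarrow>
     X \<in> borel_measurable M \<and> integrable M (\<lambda>\<omega>. X \<omega> ^ 4) \<and> (\<integral>\<omega>. X \<omega> \<partial>M) = 0 \<and>
     (\<integral>\<omega>. X \<omega> ^ 4 \<partial>M) \<le> K * (\<integral>\<omega>. (X \<omega>)\<^sup>2 \<partial>M)\<^sup>2"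

lemma kurtosis_leI:
  assumes "X \<in> borel_measurable M" "integrable M (\<lambda>\<omega>. X \<omega> ^ 4)" "(\<integral>\<omega>. X \<omega> \<partial>M) = 0"
    and "(\<integral>\<omega>. X \<omega> ^ 4 \<partial>M) \<le> K * (\<integral>\<omega>. (X \<omega>)\<^sup>2 \<partial>M)\<^sup>2"
  shows "kurtosis_le M K X"
  using assms by (simp add: kurtosis_le_def)

lemma
  assumes "kurtosis_le M K X"
  shows kurtosis_le_measurable: "X \<in> borel_measurable M"
    and kurtosis_le_mean: "(\<integral>\<omega>. X \<omega> \<partial>M) = 0"
    and kurtosis_le_fourth_moment: "(\<integral>\<omega>. X \<omega> ^ 4 \<partial>M) \<le> K * (\<integral>\<omega>. (X \<omega>)\<^sup>2 \<partial>M)\<^sup>2"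
  using assms by (simp_all add: kurtosis_le_def)

lemma kurtosis_le_mono:
  assumes "kurtosis_le M K X" "K \<le> L"
  shows "kurtosis_le M L X"
proof (rule kurtosis_leI)
  have "K * (\<integral>\<omega>. (X \<omega>)\<^sup>2 \<partial>M)\<^sup>2 \<le> L * (\<integral>\<omega>. (X \<omega>)\<^sup>2 \<partial>M)\<^sup>2"
    using \<open>K \<le> L\<close> by (intro mult_right_mono) auto
  then show "(\<integral>\<omega>. X \<omega> ^ 4 \<partial>M) \<le> L * (\<integral>\<omega>. (X \<omega>)\<^sup>2 \<partial>M)\<^sup>2"
    using kurtosis_le_fourth_moment[OF assms(1)] by linarith
qed (use assms(1) in \<open>auto simp: kurtosis_le_def\<close>)

lemma (in prob_space) integrable_power_kurtosis_le:
  assumes "kurtosis_le M K X" "n \<le> 4"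
  shows "integrable M (\<lambda>\<omega>. X \<omega> ^ n)"
  using assms by (intro integrable_power_mono[of X 4 n]) (auto simp: kurtosis_le_def)

lemma (in prob_space) prob_square_ge_kurtosis_le:
  assumes X: "kurtosis_le M K X" and "1 \<le> K" "0 \<le> \<theta>" "\<theta> \<le> 1"
  shows "(1 - \<theta>)\<^sup>2 / K \<le> prob {\<omega> \<in> space M. \<theta> * expectation (\<lambda>\<omega>. (X \<omega>)\<^sup>2) \<le> (X \<omega>)\<^sup>2}"
    (is "_ \<le> prob ?A")
proof (cases "expectation (\<lambda>\<omega>. (X \<omega>)\<^sup>2) = 0")
  case True
  have "(1 - \<theta>)\<^sup>2 \<le> 1"
    using assms by (intro power_le_one) auto
  then show ?thesis
    using True \<open>1 \<le> K\<close> by (simp add: prob_space divide_le_eq)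
next
  case False
  let ?m = "expectation (\<lambda>\<omega>. (X \<omega>)\<^sup>2)"
  note [measurable] = kurtosis_le_measurable[OF X]
  have "(1 - \<theta>)\<^sup>2 * ?m\<^sup>2 \<le> expectation (\<lambda>\<omega>. ((X \<omega>)\<^sup>2)\<^sup>2) * prob ?A"
    using assms integrable_power_kurtosis_le[OF X, of 4] by (intro Paley_Zygmund) auto
  also have "\<dots> \<le> K * ?m\<^sup>2 * prob ?A"
    using kurtosis_le_fourth_moment[OF X] by (intro mult_right_mono) auto
  finally have "?m\<^sup>2 * (1 - \<theta>)\<^sup>2 \<le> ?m\<^sup>2 * (K * prob ?A)"
    by (simp add: mult_ac)
  then have "(1 - \<theta>)\<^sup>2 \<le> K * prob ?A"
    using False by (simp add: mult_le_cancel_left)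
  then show ?thesis
    using \<open>1 \<le> K\<close> by (simp add: divide_le_eq mult.commute)
qed

lemma kurtosis_le_cmult:
  assumes "kurtosis_le M K X"
  shows "kurtosis_le M K (\<lambda>\<omega>. c * X \<omega>)"
proof (rule kurtosis_leI)
  have "c ^ 4 * (\<integral>\<omega>. X \<omega> ^ 4 \<partial>M) \<le> c ^ 4 * (K * (\<integral>\<omega>. (X \<omega>)\<^sup>2 \<partial>M)\<^sup>2)"
    using kurtosis_le_fourth_moment[OF assms] by (intro mult_left_mono) auto
  then show "(\<integral>\<omega>. (c * X \<omega>) ^ 4 \<partial>M) \<le> K * (\<integral>\<omega>. (c * X \<omega>)\<^sup>2 \<partial>M)\<^sup>2"
    by (simp add: power_mult_distrib mult_ac)
qed (use assms in \<open>auto simp: kurtosis_le_def power_mult_distrib\<close>)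

lemma kurtosis_le_distr:
  assumes "kurtosis_le (distr M N T) K f" "T \<in> measurable M N"
  shows "kurtosis_le M K (\<lambda>x. f (T x))"
  using assms by (auto simp: kurtosis_le_def integrable_distr_eq integral_distr)

lemma (in prob_space) has_bochner_integral_power_mult_indep:
  fixes X Y :: "'a \<Rightarrow> real"
  assumes "indep_var borel X borel Y"
    and "integrable M (\<lambda>\<omega>. X \<omega> ^ p)" "integrable M (\<lambda>\<omega>. Y \<omega> ^ q)"
  shows "has_bochner_integral M (\<lambda>\<omega>. X \<omega> ^ p * Y \<omega> ^ q)
    (expectation (\<lambda>\<omega>. X \<omega> ^ p) * expectation (\<lambda>\<omega>. Y \<omega> ^ q))"
proof -
  have "indep_var borel (\<lambda>\<omega>. X \<omega> ^ p) borel (\<lambda>\<omega>. Y \<omega> ^ q)"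
    using indep_var_compose[OF assms(1), of "\<lambda>x. x ^ p" borel "\<lambda>x. x ^ q" borel]
    by (simp add: comp_def)
  then show ?thesis
    using assms(2,3)
    by (simp add: has_bochner_integral_iff indep_var_integrable indep_var_lebesgue_integral)
qed

lemma (in prob_space) has_bochner_integral_power2_add_indep:
  fixes X Y :: "'a \<Rightarrow> real"
  assumes indep: "indep_var borel X borel Y" and mean: "expectation X = 0"
    and int_X: "integrable M (\<lambda>\<omega>. (X \<omega>)\<^sup>2)" and int_Y: "integrable M (\<lambda>\<omega>. (Y \<omega>)\<^sup>2)"
  shows "has_bochner_integral M (\<lambda>\<omega>. (X \<omega> + Y \<omega>)\<^sup>2)
    (expectation (\<lambda>\<omega>. (X \<omega>)\<^sup>2) + expectation (\<lambda>\<omega>. (Y \<omega>)\<^sup>2))"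
proof -
  have "integrable M X" "integrable M Y"
    using square_integrable_imp_integrable int_X int_Y
      indep_var_rv1[OF indep] indep_var_rv2[OF indep] by blast+
  then show ?thesis
    using has_bochner_integral_power_mult_indep[OF indep, of 1 1] mean int_X int_Y
    by (simp add: has_bochner_integral_iff power2_sum mult.assoc)
qed

lemma (in prob_space) has_bochner_integral_power4_add_indep:
  fixes X Y :: "'a \<Rightarrow> real"
  assumes indep: "indep_var borel X borel Y" and mean: "expectation X = 0" "expectation Y = 0"
    and int_X: "integrable M (\<lambda>\<omega>. X \<omega> ^ 4)" and int_Y: "integrable M (\<lambda>\<omega>. Y \<omega> ^ 4)"
  shows "has_bochner_integral M (\<lambda>\<omega>. (X \<omega> + Y \<omega>) ^ 4)
    (expectation (\<lambda>\<omega>. X \<omega> ^ 4)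
      + 6 * (expectation (\<lambda>\<omega>. (X \<omega>)\<^sup>2) * expectation (\<lambda>\<omega>. (Y \<omega>)\<^sup>2))
      + expectation (\<lambda>\<omega>. Y \<omega> ^ 4))"
proof -
  have "integrable M (\<lambda>\<omega>. X \<omega> ^ n)" "integrable M (\<lambda>\<omega>. Y \<omega> ^ n)" if "n \<le> 4" for n
    using integrable_power_mono[OF _ int_X that] integrable_power_mono[OF _ int_Y that]
      indep_var_rv1[OF indep] indep_var_rv2[OF indep] by simp_all
  note mixed = has_bochner_integral_power_mult_indep[OF indep this]
  have "(x + y) ^ 4 = x ^ 4 + 4 * (x ^ 3 * y) + 6 * (x\<^sup>2 * y\<^sup>2) + 4 * (x * y ^ 3) + y ^ 4"
    for x y :: real
    by (simp add: power2_eq_square power3_eq_cube power4_eq_xxxx algebra_simps)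
  then show ?thesis
    using int_X int_Y mixed[of 3 1] mixed[of 2 2] mixed[of 1 3]
    by (simp add: has_bochner_integral_iff mean)
qed

lemma (in prob_space) kurtosis_le_add_indep:
  assumes indep: "indep_var borel X borel Y" and X: "kurtosis_le M K X" and Y: "kurtosis_le M K Y"
    and "3 \<le> K"
  shows "kurtosis_le M K (\<lambda>\<omega>. X \<omega> + Y \<omega>)"
proof (rule kurtosis_leI)
  let ?a = "expectation (\<lambda>\<omega>. (X \<omega>)\<^sup>2)" and ?b = "expectation (\<lambda>\<omega>. (Y \<omega>)\<^sup>2)"
  note int_power = integrable_power_kurtosis_le[OF X] integrable_power_kurtosis_le[OF Y]
    and mean = kurtosis_le_mean[OF X] kurtosis_le_mean[OF Y]
  note power2 = has_bochner_integral_power2_add_indep[OF indep mean(1) int_power]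
    and power4 = has_bochner_integral_power4_add_indep[OF indep mean int_power]
  show "(\<lambda>\<omega>. X \<omega> + Y \<omega>) \<in> borel_measurable M"
    using kurtosis_le_measurable[OF X] kurtosis_le_measurable[OF Y] by measurable
  show "integrable M (\<lambda>\<omega>. (X \<omega> + Y \<omega>) ^ 4)"
    using power4 by (simp add: has_bochner_integral_iff)
  show "expectation (\<lambda>\<omega>. X \<omega> + Y \<omega>) = 0"
    using int_power[of 1] mean by simp
  have "expectation (\<lambda>\<omega>. (X \<omega> + Y \<omega>) ^ 4)
      = expectation (\<lambda>\<omega>. X \<omega> ^ 4) + 6 * (?a * ?b) + expectation (\<lambda>\<omega>. Y \<omega> ^ 4)"
    using power4 by (simp add: has_bochner_integral_iff)
  also have "\<dots> \<le> K * ?a\<^sup>2 + 2 * K * (?a * ?b) + K * ?b\<^sup>2"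
    using kurtosis_le_fourth_moment[OF X] kurtosis_le_fourth_moment[OF Y] \<open>3 \<le> K\<close>
    by (intro add_mono mult_right_mono mult_nonneg_nonneg) auto
  also have "\<dots> = K * (?a + ?b)\<^sup>2"
    by (simp add: power2_sum algebra_simps)
  also have "?a + ?b = expectation (\<lambda>\<omega>. (X \<omega> + Y \<omega>)\<^sup>2)"
    using power2 by (simp add: has_bochner_integral_iff)
  finally show "expectation (\<lambda>\<omega>. (X \<omega> + Y \<omega>) ^ 4) \<le> K * (expectation (\<lambda>\<omega>. (X \<omega> + Y \<omega>)\<^sup>2))\<^sup>2" .
qed

lemma (in prob_space) indep_var_linear_form:
  fixes \<xi> :: "'i \<Rightarrow> 'a \<Rightarrow> real"
  assumes "finite I" "i \<notin> I" "indep_vars (\<lambda>_. borel) \<xi> (insert i I)"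
  shows "indep_var borel (\<lambda>\<omega>. c i * \<xi> i \<omega>) borel (\<lambda>\<omega>. \<Sum>j\<in>I. c j * \<xi> j \<omega>)"
proof (rule indep_vars_sum[OF assms(1,2)])
  show "indep_vars (\<lambda>_. borel) (\<lambda>j \<omega>. c j * \<xi> j \<omega>) (insert i I)"
    using indep_vars_compose2[OF assms(3), of "\<lambda>j x. c j * x"] by simp
qed

lemma (in prob_space) has_bochner_integral_power2_linear_form:
  fixes \<xi> :: "'i \<Rightarrow> 'a \<Rightarrow> real"
  assumes "finite I" "indep_vars (\<lambda>_. borel) \<xi> I"
    and "\<And>i. i \<in> I \<Longrightarrow> expectation (\<xi> i) = 0"
    and "\<And>i. i \<in> I \<Longrightarrow> integrable M (\<lambda>\<omega>. (\<xi> i \<omega>)\<^sup>2)"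
  shows "has_bochner_integral M (\<lambda>\<omega>. (\<Sum>i\<in>I. c i * \<xi> i \<omega>)\<^sup>2)
    (\<Sum>i\<in>I. (c i)\<^sup>2 * expectation (\<lambda>\<omega>. (\<xi> i \<omega>)\<^sup>2))"
  using assms
proof (induction I rule: finite_induct)
  case (insert i I)
  have indep: "indep_var borel (\<lambda>\<omega>. c i * \<xi> i \<omega>) borel (\<lambda>\<omega>. \<Sum>j\<in>I. c j * \<xi> j \<omega>)"
    using insert by (intro indep_var_linear_form)
  have "has_bochner_integral M (\<lambda>\<omega>. (\<Sum>j\<in>I. c j * \<xi> j \<omega>)\<^sup>2)
      (\<Sum>j\<in>I. (c j)\<^sup>2 * expectation (\<lambda>\<omega>. (\<xi> j \<omega>)\<^sup>2))"
    using insert by (auto intro: indep_vars_subset)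
  then show ?case
    using insert has_bochner_integral_power2_add_indep[OF indep]
    by (simp add: has_bochner_integral_iff power_mult_distrib)
qed (simp add: has_bochner_integral_zero)

lemma (in prob_space) kurtosis_le_linear_form:
  fixes \<xi> :: "'i \<Rightarrow> 'a \<Rightarrow> real"
  assumes "finite I" "indep_vars (\<lambda>_. borel) \<xi> I" "\<And>i. i \<in> I \<Longrightarrow> kurtosis_le M K (\<xi> i)" "3 \<le> K"
  shows "kurtosis_le M K (\<lambda>\<omega>. \<Sum>i\<in>I. c i * \<xi> i \<omega>)"
  using assms
proof (induction I rule: finite_induct)
  case empty
  then show ?case
    by (simp add: kurtosis_le_def)
next
  case (insert i I)
  have "kurtosis_le M K (\<lambda>\<omega>. c i * \<xi> i \<omega> + (\<Sum>j\<in>I. c j * \<xi> j \<omega>))"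
  proof (rule kurtosis_le_add_indep)
    show "indep_var borel (\<lambda>\<omega>. c i * \<xi> i \<omega>) borel (\<lambda>\<omega>. \<Sum>j\<in>I. c j * \<xi> j \<omega>)"
      using insert by (intro indep_var_linear_form)
    show "kurtosis_le M K (\<lambda>\<omega>. c i * \<xi> i \<omega>)"
      using insert by (intro kurtosis_le_cmult) simp
    show "kurtosis_le M K (\<lambda>\<omega>. \<Sum>j\<in>I. c j * \<xi> j \<omega>)"
      using insert by (intro insert.IH) (auto intro: indep_vars_subset)
  qed fact
  then show ?case
    using insert by simp
qed

lemma (in prob_space) second_moment_linear_form_kurtosis_le:
  fixes \<xi> :: "'i \<Rightarrow> 'a \<Rightarrow> real"
  assumes "finite I" "indep_vars (\<lambda>_. borel) \<xi> I" and \<xi>: "\<And>i. i \<in> I \<Longrightarrow> kurtosis_le M K (\<xi> i)"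
  shows "expectation (\<lambda>\<omega>. (\<Sum>i\<in>I. c i * \<xi> i \<omega>)\<^sup>2)
    = (\<Sum>i\<in>I. (c i)\<^sup>2 * expectation (\<lambda>\<omega>. (\<xi> i \<omega>)\<^sup>2))"
  using assms integrable_power_kurtosis_le[OF \<xi>, of _ 2] kurtosis_le_mean[OF \<xi>]
  by (intro has_bochner_integral_integral_eq[OF has_bochner_integral_power2_linear_form]) auto

lemma (in prob_space)
  assumes X: "kurtosis_le M K X" and Y: "kurtosis_le M K Y" and "0 \<le> K"
  shows integrable_power2_mult_kurtosis_le: "integrable M (\<lambda>\<omega>. (X \<omega>)\<^sup>2 * (Y \<omega>)\<^sup>2)"
    and expectation_power2_mult_kurtosis_le: "expectation (\<lambda>\<omega>. (X \<omega>)\<^sup>2 * (Y \<omega>)\<^sup>2)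
      \<le> K * (expectation (\<lambda>\<omega>. (X \<omega>)\<^sup>2) * expectation (\<lambda>\<omega>. (Y \<omega>)\<^sup>2))"
proof -
  let ?a = "expectation (\<lambda>\<omega>. (X \<omega>)\<^sup>2)" and ?b = "expectation (\<lambda>\<omega>. (Y \<omega>)\<^sup>2)"
  note [measurable] = kurtosis_le_measurable[OF X] kurtosis_le_measurable[OF Y]
  have int_power4: "integrable M (\<lambda>\<omega>. ((X \<omega>)\<^sup>2)\<^sup>2)" "integrable M (\<lambda>\<omega>. ((Y \<omega>)\<^sup>2)\<^sup>2)"
    using integrable_power_kurtosis_le[OF X, of 4] integrable_power_kurtosis_le[OF Y, of 4]
    by simp_all
  then show "integrable M (\<lambda>\<omega>. (X \<omega>)\<^sup>2 * (Y \<omega>)\<^sup>2)"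
    by (intro integrable_mult_of_power2) auto
  have "(expectation (\<lambda>\<omega>. (X \<omega>)\<^sup>2 * (Y \<omega>)\<^sup>2))\<^sup>2
      \<le> expectation (\<lambda>\<omega>. ((X \<omega>)\<^sup>2)\<^sup>2) * expectation (\<lambda>\<omega>. ((Y \<omega>)\<^sup>2)\<^sup>2)"
    using int_power4 by (intro Cauchy_Schwarz_integral) auto
  also have "\<dots> \<le> (K * ?a\<^sup>2) * (K * ?b\<^sup>2)"
    using kurtosis_le_fourth_moment[OF X] kurtosis_le_fourth_moment[OF Y] \<open>0 \<le> K\<close>
    by (intro mult_mono) auto
  also have "\<dots> = (K * (?a * ?b))\<^sup>2"
    by (simp add: power2_eq_square mult_ac)
  finally show "expectation (\<lambda>\<omega>. (X \<omega>)\<^sup>2 * (Y \<omega>)\<^sup>2) \<le> K * (?a * ?b)"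
    using \<open>0 \<le> K\<close> by (auto intro: power2_le_imp_le)
qed

lemma (in prob_space)
  assumes Z: "\<And>j. j \<in> J \<Longrightarrow> kurtosis_le M K (Z j)"
    and c: "\<And>j. j \<in> J \<Longrightarrow> 0 \<le> c j" and "0 \<le> K"
  shows integrable_power2_sum_power2: "integrable M (\<lambda>\<omega>. (\<Sum>j\<in>J. c j * (Z j \<omega>)\<^sup>2)\<^sup>2)"
    and expectation_power2_sum_power2_le: "expectation (\<lambda>\<omega>. (\<Sum>j\<in>J. c j * (Z j \<omega>)\<^sup>2)\<^sup>2)
      \<le> K * (expectation (\<lambda>\<omega>. \<Sum>j\<in>J. c j * (Z j \<omega>)\<^sup>2))\<^sup>2"
proof -
  let ?v = "\<lambda>j. expectation (\<lambda>\<omega>. (Z j \<omega>)\<^sup>2)"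
  have square_sum: "(\<Sum>j\<in>J. c j * f j)\<^sup>2 = (\<Sum>j\<in>J. \<Sum>l\<in>J. c j * c l * (f j * f l))"
    for f :: "_ \<Rightarrow> real"
    by (simp add: power2_eq_square sum_product mult_ac)
  note integrable_mult = integrable_power2_mult_kurtosis_le[OF Z Z \<open>0 \<le> K\<close>]
    and expectation_mult_le = expectation_power2_mult_kurtosis_le[OF Z Z \<open>0 \<le> K\<close>]
  show "integrable M (\<lambda>\<omega>. (\<Sum>j\<in>J. c j * (Z j \<omega>)\<^sup>2)\<^sup>2)"
    unfolding square_sum using integrable_mult
    by (intro Bochner_Integration.integrable_sum integrable_mult_right)
  have "expectation (\<lambda>\<omega>. (\<Sum>j\<in>J. c j * (Z j \<omega>)\<^sup>2)\<^sup>2)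
      = (\<Sum>j\<in>J. \<Sum>l\<in>J. c j * c l * expectation (\<lambda>\<omega>. (Z j \<omega>)\<^sup>2 * (Z l \<omega>)\<^sup>2))"
    unfolding square_sum using integrable_mult by simp
  also have "\<dots> \<le> (\<Sum>j\<in>J. \<Sum>l\<in>J. c j * c l * (K * (?v j * ?v l)))"
    using expectation_mult_le c by (intro sum_mono mult_left_mono) auto
  also have "\<dots> = K * (\<Sum>j\<in>J. c j * ?v j)\<^sup>2"
    unfolding square_sum by (simp add: sum_distrib_left mult_ac)
  also have "(\<Sum>j\<in>J. c j * ?v j) = expectation (\<lambda>\<omega>. \<Sum>j\<in>J. c j * (Z j \<omega>)\<^sup>2)"
    using integrable_power_kurtosis_le[OF Z, of _ 2] by simp
  finally show "expectation (\<lambda>\<omega>. (\<Sum>j\<in>J. c j * (Z j \<omega>)\<^sup>2)\<^sup>2)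
      \<le> K * (expectation (\<lambda>\<omega>. \<Sum>j\<in>J. c j * (Z j \<omega>)\<^sup>2))\<^sup>2" .
qed

lemma (in pair_prob_space) kurtosis_le_pair_measure:
  fixes f :: "'a \<times> 'b \<Rightarrow> real"
  defines "v \<equiv> \<lambda>x. \<integral>y. (f (x, y))\<^sup>2 \<partial>M2"
  assumes [measurable]: "f \<in> borel_measurable (M1 \<Otimes>\<^sub>M M2)"
    and f: "\<And>x. x \<in> space M1 \<Longrightarrow> kurtosis_le M2 L (\<lambda>y. f (x, y))"
    and integrable_v: "integrable M1 (\<lambda>x. (v x)\<^sup>2)"
    and v_le: "(\<integral>x. (v x)\<^sup>2 \<partial>M1) \<le> K * (\<integral>x. v x \<partial>M1)\<^sup>2"
    and "0 \<le> L"
  shows "kurtosis_le (M1 \<Otimes>\<^sub>M M2) (K * L) f"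
proof (rule kurtosis_leI)
  have section_le: "(\<integral>y. f (x, y) ^ 4 \<partial>M2) \<le> L * (v x)\<^sup>2" if "x \<in> space M1" for x
    using kurtosis_le_fourth_moment[OF f[OF that]] by (simp add: v_def)
  show integrable_power4: "integrable (M1 \<Otimes>\<^sub>M M2) (\<lambda>z. f z ^ 4)"
    using integrable_v section_le M2.integrable_power_kurtosis_le[OF f]
    by (intro Fubini_integrable_bound[where g = "\<lambda>x. L * (v x)\<^sup>2"]) auto
  have integrable_power: "integrable (M1 \<Otimes>\<^sub>M M2) (\<lambda>z. f z ^ n)" if "n \<le> 4" for n
    using P.integrable_power_mono[OF _ integrable_power4 that] by simp
  have "(\<integral>z. f z \<partial>(M1 \<Otimes>\<^sub>M M2)) = (\<integral>x. (\<integral>y. f (x, y) \<partial>M2) \<partial>M1)"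
    using integrable_power[of 1] by (simp add: integral_fst')
  also have "\<dots> = (\<integral>x. 0 \<partial>M1)"
    using kurtosis_le_mean[OF f] by (intro Bochner_Integration.integral_cong) auto
  finally show "(\<integral>z. f z \<partial>(M1 \<Otimes>\<^sub>M M2)) = 0"
    by simp
  have "(\<integral>z. f z ^ 4 \<partial>(M1 \<Otimes>\<^sub>M M2)) = (\<integral>x. (\<integral>y. f (x, y) ^ 4 \<partial>M2) \<partial>M1)"
    using integral_fst'[OF integrable_power4] by simp
  also have "\<dots> \<le> (\<integral>x. L * (v x)\<^sup>2 \<partial>M1)"
    using section_le integrable_v integrable_fst'[OF integrable_power4]
    by (intro integral_mono) auto
  also have "\<dots> \<le> L * (K * (\<integral>x. v x \<partial>M1)\<^sup>2)"
    using v_le \<open>0 \<le> L\<close> by (simp add: mult_left_mono)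
  also have "(\<integral>x. v x \<partial>M1) = (\<integral>z. (f z)\<^sup>2 \<partial>(M1 \<Otimes>\<^sub>M M2))"
    unfolding v_def using integral_fst'[OF integrable_power[of 2]] by simp
  finally show "(\<integral>z. f z ^ 4 \<partial>(M1 \<Otimes>\<^sub>M M2)) \<le> K * L * (\<integral>z. (f z)\<^sup>2 \<partial>(M1 \<Otimes>\<^sub>M M2))\<^sup>2"
    by (simp add: mult_ac)
qed measurable

lemma (in pair_prob_space)
  fixes B :: "'j \<Rightarrow> 'a \<Rightarrow> real" and \<eta> :: "'j \<Rightarrow> 'b \<Rightarrow> real"
  assumes J: "finite J" and indep: "M2.indep_vars (\<lambda>_. borel) \<eta> J"
    and B: "\<And>j. j \<in> J \<Longrightarrow> kurtosis_le M1 K (B j)" and \<eta>: "\<And>j. j \<in> J \<Longrightarrow> kurtosis_le M2 L (\<eta> j)"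
    and K: "0 \<le> K" and L: "3 \<le> L"
  defines "W \<equiv> \<lambda>(x, y). \<Sum>j\<in>J. B j x * \<eta> j y"
  shows kurtosis_le_random_linear_form: "kurtosis_le (M1 \<Otimes>\<^sub>M M2) (K * L) W"
    and second_moment_random_linear_form: "(\<integral>z. (W z)\<^sup>2 \<partial>(M1 \<Otimes>\<^sub>M M2))
      = (\<Sum>j\<in>J. (\<integral>x. (B j x)\<^sup>2 \<partial>M1) * (\<integral>y. (\<eta> j y)\<^sup>2 \<partial>M2))"
proof -
  let ?v = "\<lambda>j. \<integral>y. (\<eta> j y)\<^sup>2 \<partial>M2"
  have section_moment: "(\<integral>y. (W (x, y))\<^sup>2 \<partial>M2) = (\<Sum>j\<in>J. ?v j * (B j x)\<^sup>2)" for x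
    using M2.second_moment_linear_form_kurtosis_le[OF J indep \<eta>, of "\<lambda>j. B j x"]
    by (simp add: W_def mult.commute)
  show W: "kurtosis_le (M1 \<Otimes>\<^sub>M M2) (K * L) W"
  proof (rule kurtosis_le_pair_measure)
    note [measurable] = kurtosis_le_measurable[OF B] kurtosis_le_measurable[OF \<eta>]
    show "W \<in> borel_measurable (M1 \<Otimes>\<^sub>M M2)"
      unfolding W_def by measurable
    show "kurtosis_le M2 L (\<lambda>y. W (x, y))" for x
      unfolding W_def prod.case using J indep \<eta> L by (intro M2.kurtosis_le_linear_form)
    show "integrable M1 (\<lambda>x. (\<integral>y. (W (x, y))\<^sup>2 \<partial>M2)\<^sup>2)"
      and "(\<integral>x. (\<integral>y. (W (x, y))\<^sup>2 \<partial>M2)\<^sup>2 \<partial>M1) \<le> K * (\<integral>x. (\<integral>y. (W (x, y))\<^sup>2 \<partial>M2) \<partial>M1)\<^sup>2"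
      unfolding section_moment using B K
      by (intro M1.integrable_power2_sum_power2 M1.expectation_power2_sum_power2_le; simp)+
  qed (use L in simp)
  have "(\<integral>z. (W z)\<^sup>2 \<partial>(M1 \<Otimes>\<^sub>M M2)) = (\<integral>x. (\<Sum>j\<in>J. ?v j * (B j x)\<^sup>2) \<partial>M1)"
    using integral_fst'[OF P.integrable_power_kurtosis_le[OF W, of 2]] by (simp add: section_moment)
  also have "\<dots> = (\<Sum>j\<in>J. (\<integral>x. (B j x)\<^sup>2 \<partial>M1) * ?v j)"
    using M1.integrable_power_kurtosis_le[OF B, of _ 2] by (simp add: mult.commute)
  finally show "(\<integral>z. (W z)\<^sup>2 \<partial>(M1 \<Otimes>\<^sub>M M2)) = (\<Sum>j\<in>J. (\<integral>x. (B j x)\<^sup>2 \<partial>M1) * ?v j)" .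
qed

lemma (in pair_prob_space)
  fixes \<xi> :: "'i \<Rightarrow> 'a \<Rightarrow> real" and \<eta> :: "'j \<Rightarrow> 'b \<Rightarrow> real" and d :: "'i \<Rightarrow> 'j \<Rightarrow> real"
  assumes I: "finite I" "M1.indep_vars (\<lambda>_. borel) \<xi> I" "\<And>i. i \<in> I \<Longrightarrow> kurtosis_le M1 K (\<xi> i)" "3 \<le> K"
    and J: "finite J" "M2.indep_vars (\<lambda>_. borel) \<eta> J" "\<And>j. j \<in> J \<Longrightarrow> kurtosis_le M2 L (\<eta> j)" "3 \<le> L"
  defines "W \<equiv> \<lambda>(x, y). \<Sum>(i, j)\<in>I \<times> J. d i j * \<xi> i x * \<eta> j y"
  shows kurtosis_le_bilinear_form: "kurtosis_le (M1 \<Otimes>\<^sub>M M2) (K * L) W"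
    and second_moment_bilinear_form: "(\<integral>z. (W z)\<^sup>2 \<partial>(M1 \<Otimes>\<^sub>M M2))
      = (\<Sum>(i, j)\<in>I \<times> J. (d i j)\<^sup>2 * (\<integral>x. (\<xi> i x)\<^sup>2 \<partial>M1) * (\<integral>y. (\<eta> j y)\<^sup>2 \<partial>M2))"
proof -
  let ?B = "\<lambda>j x. \<Sum>i\<in>I. d i j * \<xi> i x"
  have swap: "(\<Sum>(i, j)\<in>I \<times> J. f i j) = (\<Sum>j\<in>J. \<Sum>i\<in>I. f i j)" for f :: "'i \<Rightarrow> 'j \<Rightarrow> real"
    by (subst sum.swap) (simp add: sum.cartesian_product)
  have W_eq: "W = (\<lambda>(x, y). \<Sum>j\<in>J. ?B j x * \<eta> j y)"
    by (simp add: W_def swap sum_distrib_right)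
  have B: "kurtosis_le M1 K (?B j)" for j
    using I by (intro M1.kurtosis_le_linear_form)
  have second_moment_B: "(\<integral>x. (?B j x)\<^sup>2 \<partial>M1) = (\<Sum>i\<in>I. (d i j)\<^sup>2 * (\<integral>x. (\<xi> i x)\<^sup>2 \<partial>M1))" for j
    using I by (intro M1.second_moment_linear_form_kurtosis_le)
  have "0 \<le> K"
    using \<open>3 \<le> K\<close> by simp
  show "kurtosis_le (M1 \<Otimes>\<^sub>M M2) (K * L) W"
    unfolding W_eq using J B \<open>0 \<le> K\<close> by (intro kurtosis_le_random_linear_form)
  have "(\<integral>z. (W z)\<^sup>2 \<partial>(M1 \<Otimes>\<^sub>M M2)) = (\<Sum>j\<in>J. (\<integral>x. (?B j x)\<^sup>2 \<partial>M1) * (\<integral>y. (\<eta> j y)\<^sup>2 \<partial>M2))"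
    unfolding W_eq using J B \<open>0 \<le> K\<close>
    by (intro second_moment_random_linear_form[where K = K and L = L])
  then show "(\<integral>z. (W z)\<^sup>2 \<partial>(M1 \<Otimes>\<^sub>M M2))
      = (\<Sum>(i, j)\<in>I \<times> J. (d i j)\<^sup>2 * (\<integral>x. (\<xi> i x)\<^sup>2 \<partial>M1) * (\<integral>y. (\<eta> j y)\<^sup>2 \<partial>M2))"
    by (simp add: second_moment_B swap sum_distrib_right)
qed

subsection \<open>Uniform measures on cubes\<close>

lemma PiM_uniform_count_measure:
  assumes "finite I" and B: "\<And>i. finite (B i)"
  shows "PiM I (\<lambda>i. uniform_count_measure (B i)) = uniform_count_measure (PiE I B)"
proof -
  interpret product_sigma_finite "\<lambda>i. uniform_count_measure (B i)"
    using B by (intro product_sigma_finite.intro finite_measure.axioms(1) finite_measureI)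
      (auto simp: emeasure_uniform_count_measure space_uniform_count_measure)
  show ?thesis
  proof (rule PiM_eqI[symmetric])
    have "sets (PiM I (\<lambda>i. uniform_count_measure (B i))) = sets (PiM I (\<lambda>i. count_space (B i)))"
      by (intro sets_PiM_cong) (auto simp: sets_uniform_count_measure)
    then show "sets (uniform_count_measure (PiE I B))
        = sets (PiM I (\<lambda>i. uniform_count_measure (B i)))"
      using assms by (simp add: count_space_PiM_finite countable_finite sets_uniform_count_measure)
    fix A assume "\<And>i. i \<in> I \<Longrightarrow> A i \<in> sets (uniform_count_measure (B i))"
    then have A: "A i \<subseteq> B i" if "i \<in> I" for i
      using that by (auto simp: sets_uniform_count_measure)
    then have "emeasure (uniform_count_measure (PiE I B)) (PiE I A)
        = ennreal (\<Prod>i\<in>I. card (A i) / card (B i))"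
      using assms
      by (subst emeasure_uniform_count_measure)
        (auto simp: finite_PiE card_PiE prod_dividef PiE_mono)
    also have "\<dots> = (\<Prod>i\<in>I. emeasure (uniform_count_measure (B i)) (A i))"
      using A B by (simp add: emeasure_uniform_count_measure flip: prod_ennreal)
    finally show "emeasure (uniform_count_measure (PiE I B)) (PiE I A)
        = (\<Prod>i\<in>I. emeasure (uniform_count_measure (B i)) (A i))" .
  qed fact
qed

lemma (in product_prob_space) indep_vars_coordinates:
  "prob_space.indep_vars (PiM I M) M (\<lambda>i \<omega>. \<omega> i) I"
proof -
  interpret P: prob_space "PiM I M"
    by (intro prob_space_PiM prob_space)
  show ?thesis
  proof (cases "I = {}")
    case True
    then show ?thesis
      unfolding P.indep_vars_def P.indep_sets_def by simp
  next
    case False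
    have "distr (PiM I M) (PiM I M) (\<lambda>\<omega>. \<lambda>i\<in>I. \<omega> i) = PiM I M"
      by (subst distr_cong[OF refl refl, of _ _ "\<lambda>\<omega>. \<omega>"]) (auto simp: space_PiM distr_id)
    also have "\<dots> = PiM I (\<lambda>i. distr (PiM I M) (M i) (\<lambda>\<omega>. \<omega> i))"
      using prob_space by (intro PiM_cong refl) (simp add: distr_PiM_component)
    finally show ?thesis
      using False by (subst P.indep_vars_iff_distr_eq_PiM') auto
  qed
qed

lemma
  fixes I :: "'i set"
  assumes "finite I"
  defines "U \<equiv> uniform_count_measure (I \<rightarrow>\<^sub>E {0, 1 :: real})"
  shows indep_vars_uniform_bits: "prob_space.indep_vars U (\<lambda>_. borel) (\<lambda>i x. x i - 1 / 2) I"
    and kurtosis_le_uniform_bit: "i \<in> I \<Longrightarrow> kurtosis_le U 1 (\<lambda>x. x i - 1 / 2)"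
    and second_moment_uniform_bit: "i \<in> I \<Longrightarrow> (\<integral>x. (x i - 1 / 2)\<^sup>2 \<partial>U) = 1 / 4"
proof -
  let ?N = "uniform_count_measure {0, 1 :: real}"
  interpret product_prob_space "\<lambda>_ :: 'i. ?N" I
    by (intro product_prob_spaceI prob_space_uniform_count_measure) auto
  have U: "U = PiM I (\<lambda>_. ?N)"
    unfolding U_def using \<open>finite I\<close> by (simp add: PiM_uniform_count_measure)
  interpret U: prob_space U
    unfolding U by (intro prob_space_PiM prob_space)
  have shift: "(\<lambda>x. x - 1 / 2) \<in> borel_measurable ?N"
    by (simp add: measurable_cong_sets[OF sets_uniform_count_measure_count_space refl])
  have "U.indep_vars (\<lambda>_. ?N) (\<lambda>i x. x i) I"
    unfolding U by (rule indep_vars_coordinates)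
  then show "U.indep_vars (\<lambda>_. borel) (\<lambda>i x. x i - 1 / 2) I"
    by (rule U.indep_vars_compose2) (rule shift)
  assume "i \<in> I"
  then have coordinate: "(\<lambda>x. x i) \<in> measurable U ?N" and distr: "distr U ?N (\<lambda>x. x i) = ?N"
    unfolding U using distr_PiM_component[of I "\<lambda>_. ?N" i] prob_space by simp_all
  have "kurtosis_le ?N 1 (\<lambda>t. t - 1 / 2)"
  proof (rule kurtosis_leI)
    show "integrable ?N (\<lambda>t. (t - 1 / 2) ^ 4)"
      unfolding uniform_count_measure_def by (rule integrable_point_measure_finite) simp
  qed (use shift in \<open>auto simp: integral_uniform_count_measure power_divide\<close>)
  then show "kurtosis_le U 1 (\<lambda>x. x i - 1 / 2)"
    using kurtosis_le_distr[of U ?N "\<lambda>x. x i"] coordinate by (simp add: distr)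
  have "(\<integral>x. (x i - 1 / 2)\<^sup>2 \<partial>U) = (\<integral>t. (t - 1 / 2)\<^sup>2 \<partial>?N)"
    using integral_distr[OF coordinate, of "\<lambda>t. (t - 1 / 2)\<^sup>2"] shift by (simp add: distr)
  also have "\<dots> = 1 / 4"
    by (simp add: integral_uniform_count_measure power_divide)
  finally show "(\<integral>x. (x i - 1 / 2)\<^sup>2 \<partial>U) = 1 / 4" .
qed

subsection \<open>Matrices with vanishing line sums\<close>

lemma bilin_diff_const:
  assumes "zero_line_sums k \<delta>"
  shows "bilin k \<delta> (\<lambda>i. x i - a) (\<lambda>j. y j - b) = bilin k \<delta> x y"
proof -
  have row: "(\<Sum>j\<in>{1..k}. \<delta> i j * u) = 0" and col: "(\<Sum>j\<in>{1..k}. \<delta> j i * u) = 0"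
    if "i \<in> {1..k}" for i u
    using assms that by (auto simp: zero_line_sums_def simp flip: sum_distrib_right)
  have "(\<Sum>i\<in>{1..k}. \<Sum>j\<in>{1..k}. \<delta> i j * (a * y j)) = 0"
    by (subst sum.swap) (intro sum.neutral ballI col)
  moreover have "(\<Sum>i\<in>{1..k}. \<Sum>j\<in>{1..k}. \<delta> i j * ((x i - a) * b)) = 0"
    by (intro sum.neutral ballI row)
  moreover have "bilin k \<delta> (\<lambda>i. x i - a) (\<lambda>j. y j - b)
      = (\<Sum>i\<in>{1..k}. \<Sum>j\<in>{1..k}.
          \<delta> i j * x i * y j - \<delta> i j * (a * y j) - \<delta> i j * ((x i - a) * b))"
    unfolding bilin_def sum.cartesian_product by (intro sum.cong) (auto simp: algebra_simps)
  ultimately show ?thesis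
    by (simp add: bilin_def sum.cartesian_product sum_subtractf)
qed

lemma frob_norm_power2: "(frob_norm k \<delta>)\<^sup>2 = (\<Sum>(i, j)\<in>{1..k} \<times> {1..k}. (\<delta> i j)\<^sup>2)"
proof -
  have "0 \<le> (\<Sum>(i, j)\<in>{1..k} \<times> {1..k}. (\<delta> i j)\<^sup>2)"
    by (intro sum_nonneg) auto
  then show ?thesis
    by (simp add: frob_norm_def)
qed

lemma
  assumes "zero_line_sums k \<delta>"
  defines "U \<equiv> uniform_count_measure (cube k)"
  shows kurtosis_le_bilin_uniform_cube: "kurtosis_le (U \<Otimes>\<^sub>M U) 9 (case_prod (bilin k \<delta>))"
    and second_moment_bilin_uniform_cube:
      "(\<integral>z. (case_prod (bilin k \<delta>) z)\<^sup>2 \<partial>(U \<Otimes>\<^sub>M U)) = (frob_norm k \<delta>)\<^sup>2 / 16"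
proof -
  interpret U: prob_space U
    unfolding U_def cube_def
    by (intro prob_space_uniform_count_measure) (auto simp: finite_PiE PiE_eq_empty_iff)
  interpret pair_prob_space U U ..
  let ?I = "{1..k}" and ?\<xi> = "\<lambda>i x. x i - 1 / 2 :: real"
  have indep: "U.indep_vars (\<lambda>_. borel) ?\<xi> ?I"
    using indep_vars_uniform_bits[of ?I] by (simp add: U_def cube_def)
  have kurtosis3: "kurtosis_le U 3 (?\<xi> i)" if "i \<in> ?I" for i
    unfolding U_def cube_def using that by (intro kurtosis_le_mono[OF kurtosis_le_uniform_bit]) auto
  have second_moment: "(\<integral>x. (?\<xi> i x)\<^sup>2 \<partial>U) = 1 / 4" if "i \<in> ?I" for i
    unfolding U_def cube_def using that by (intro second_moment_uniform_bit) auto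
  have bilin: "bilin k \<delta> = (\<lambda>x y. \<Sum>(i, j)\<in>?I \<times> ?I. \<delta> i j * ?\<xi> i x * ?\<xi> j y)"
  proof (intro ext)
    show "bilin k \<delta> x y = (\<Sum>(i, j)\<in>?I \<times> ?I. \<delta> i j * ?\<xi> i x * ?\<xi> j y)" for x y
      using bilin_diff_const[OF assms(1), of x "1 / 2" y "1 / 2"] by (simp add: bilin_def)
  qed
  have "kurtosis_le (U \<Otimes>\<^sub>M U) (3 * 3) (case_prod (bilin k \<delta>))"
    unfolding bilin using indep kurtosis3 by (intro kurtosis_le_bilinear_form) auto
  then show "kurtosis_le (U \<Otimes>\<^sub>M U) 9 (case_prod (bilin k \<delta>))"
    by simp
  have "(\<integral>z. (case_prod (bilin k \<delta>) z)\<^sup>2 \<partial>(U \<Otimes>\<^sub>M U))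
      = (\<Sum>(i, j)\<in>?I \<times> ?I. (\<delta> i j)\<^sup>2 * (\<integral>x. (?\<xi> i x)\<^sup>2 \<partial>U) * (\<integral>y. (?\<xi> j y)\<^sup>2 \<partial>U))"
    unfolding bilin using indep kurtosis3
    by (intro second_moment_bilinear_form[where K = 3 and L = 3]) auto
  also have "\<dots> = (\<Sum>(i, j)\<in>?I \<times> ?I. (\<delta> i j)\<^sup>2 * (1 / 4) * (1 / 4))"
    by (intro sum.cong) (auto simp: second_moment)
  also have "\<dots> = (frob_norm k \<delta>)\<^sup>2 / 16"
    by (simp add: frob_norm_power2 sum_divide_distrib case_prod_unfold)
  finally show "(\<integral>z. (case_prod (bilin k \<delta>) z)\<^sup>2 \<partial>(U \<Otimes>\<^sub>M U)) = (frob_norm k \<delta>)\<^sup>2 / 16" .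
qed

lemma
  assumes "indep_uniform_cube M k X Y"
  defines "U \<equiv> uniform_count_measure (cube k)"
  shows measurable_pair_indep_uniform_cube: "(\<lambda>\<omega>. (X \<omega>, Y \<omega>)) \<in> measurable M (U \<Otimes>\<^sub>M U)"
    and distr_pair_indep_uniform_cube:
      "distr M (U \<Otimes>\<^sub>M U) (\<lambda>\<omega>. (X \<omega>, Y \<omega>)) = U \<Otimes>\<^sub>M U"
proof -
  let ?C = "count_space (cube k)"
  interpret prob_space M
    using assms(1) by (simp add: indep_uniform_cube_def)
  have X: "X \<in> measurable M ?C" and Y: "Y \<in> measurable M ?C"
    and joint: "U \<Otimes>\<^sub>M U = distr M (?C \<Otimes>\<^sub>M ?C) (\<lambda>\<omega>. (X \<omega>, Y \<omega>))"
    using assms(1) unfolding indep_uniform_cube_def indep_var_distribution_eq U_def by metis+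
  have sets: "sets (U \<Otimes>\<^sub>M U) = sets (?C \<Otimes>\<^sub>M ?C)"
    by (simp only: joint sets_distr)
  show "(\<lambda>\<omega>. (X \<omega>, Y \<omega>)) \<in> measurable M (U \<Otimes>\<^sub>M U)"
    unfolding measurable_cong_sets[OF refl sets] using X Y by measurable
  show "distr M (U \<Otimes>\<^sub>M U) (\<lambda>\<omega>. (X \<omega>, Y \<omega>)) = U \<Otimes>\<^sub>M U"
    by (subst (2) joint) (rule distr_cong[OF refl sets refl])
qed

lemma measure_bilin_ge:
  assumes "zero_line_sums k \<delta>" and XY: "indep_uniform_cube M k X Y" and "0 \<le> \<alpha>" "\<alpha> \<le> 1 / 16"
  shows "(1 - 16 * \<alpha>)\<^sup>2 / 9
    \<le> measure M {\<omega> \<in> space M. (bilin k \<delta> (X \<omega>) (Y \<omega>))\<^sup>2 \<ge> \<alpha> * (frob_norm k \<delta>)\<^sup>2}"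
proof -
  interpret prob_space M
    using XY by (simp add: indep_uniform_cube_def)
  let ?Z = "\<lambda>\<omega>. bilin k \<delta> (X \<omega>) (Y \<omega>)"
  note pair = measurable_pair_indep_uniform_cube[OF XY] distr_pair_indep_uniform_cube[OF XY]
    and W = kurtosis_le_bilin_uniform_cube[OF assms(1)]
  have Z: "kurtosis_le M 9 ?Z"
    using kurtosis_le_distr[OF _ pair(1), of 9 "case_prod (bilin k \<delta>)"] W by (simp add: pair(2))
  have second_moment: "expectation (\<lambda>\<omega>. (?Z \<omega>)\<^sup>2) = (frob_norm k \<delta>)\<^sup>2 / 16"
    using integral_distr[OF pair(1), of "\<lambda>z. (case_prod (bilin k \<delta>) z)\<^sup>2"]
      kurtosis_le_measurable[OF W]
    by (simp add: pair(2) second_moment_bilin_uniform_cube[OF assms(1)])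
  have "(1 - 16 * \<alpha>)\<^sup>2 / 9
      \<le> prob {\<omega> \<in> space M. 16 * \<alpha> * expectation (\<lambda>\<omega>. (?Z \<omega>)\<^sup>2) \<le> (?Z \<omega>)\<^sup>2}"
    using assms(3,4) by (intro prob_square_ge_kurtosis_le Z) auto
  also have "16 * \<alpha> * expectation (\<lambda>\<omega>. (?Z \<omega>)\<^sup>2) = \<alpha> * (frob_norm k \<delta>)\<^sup>2"
    by (simp add: second_moment)
  finally show ?thesis .
qed

theorem theorem7:
  fixes \<alpha> :: real
  assumes "0 < \<alpha>" and "\<alpha> < 1 / 16"
  shows
    "(\<exists>c>0. \<forall>k\<ge>1. \<forall>\<delta> (M :: 'a measure) X Y.
        zero_line_sums k \<delta> \<longrightarrow> indep_uniform_cube M k X Y \<longrightarrow>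
        measure M {\<omega> \<in> space M. (bilin k \<delta> (X \<omega>) (Y \<omega>))\<^sup>2 \<ge> \<alpha> * (frob_norm k \<delta>)\<^sup>2} \<ge> c) \<and>
     (1 - 16 * \<alpha>)\<^sup>2 / 1024 > 0 \<and>
     (\<forall>k\<ge>1. \<forall>\<delta> (M :: 'a measure) X Y.
        zero_line_sums k \<delta> \<longrightarrow> indep_uniform_cube M k X Y \<longrightarrow>
        measure M {\<omega> \<in> space M. (bilin k \<delta> (X \<omega>) (Y \<omega>))\<^sup>2 \<ge> \<alpha> * (frob_norm k \<delta>)\<^sup>2}
          \<ge> (1 - 16 * \<alpha>)\<^sup>2 / 1024)"
proof -
  let ?c = "(1 - 16 * \<alpha>)\<^sup>2 / 1024"
  have pos: "?c > 0"
    using assms by simp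
  have bound: "?c \<le> measure M {\<omega> \<in> space M. (bilin k \<delta> (X \<omega>) (Y \<omega>))\<^sup>2 \<ge> \<alpha> * (frob_norm k \<delta>)\<^sup>2}"
    if "zero_line_sums k \<delta>" "indep_uniform_cube M k X Y" for k \<delta> X Y and M :: "'a measure"
  proof -
    have "?c \<le> (1 - 16 * \<alpha>)\<^sup>2 / 9"
      by (intro divide_left_mono) auto
    then show ?thesis
      using measure_bilin_ge[OF that, of \<alpha>] assms by linarith
  qed
  show ?thesis
    using pos bound by blast
qed

end
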